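(* Let $n\ge 1$, let $d\ge 2$ be an even integer, and let $\Vert\cdot\Vert:\mathcal{F}_{d,n}\to\mathbb{R}$ be a norm on the space of real $n$-variate forms of degree $d$. Consider the convex optimization problem $$\mathbf{P}^*_{\Vert\cdot\Vert}:\quad \mathrm{opt}^*_{\Vert\cdot\Vert}=\inf\left\{\Vert f\Vert:\ \int_{\mathbb{R}^n}\exp(-f(x))\,dx\le 1,\ f\in\mathcal{F}_{d,n}\right\}.$$ Then: (1) The problem $\mathbf{P}^*_{\Vert\cdot\Vert}$ has a unique optimal solution $f^\star$, and $f^\star\in\mathcal{V}_{d,n}$. (2) If the norm $\Vert\cdot\Vert$ is $O(n)$-invariant, then $f^\star=\kappa\,b_{d,n}$, where $b_{d,n}(x)=|x|^d=(x_1^2+\dots+x_n^2)^{d/2}$ and $$\kappa=\left(\frac{\Gamma(1+n/d)}{\Gamma(1+n/2)}\right)^{d/n}\pi^{d/2},$$ and $\mathrm{opt}^*_{\Vert\cdot\Vert}=\kappa\,\Vert b_{d,n}\Vert$.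
   Context: $\mathcal{F}_{d,n}$ is the real vector space of real homogeneous polynomials (forms) of degree $d$ in $n$ variables (including $0$). $\mathcal{V}_{d,n}$ is the set of $f\in\mathcal{F}_{d,n}$ whose sublevel set $\{x\in\mathbb{R}^n: f(x)\le 1\}$ has finite Lebesgue volume. The integral takes values in $[0,+\infty]$. An optimal solution is a form $f^\star\in\mathcal{F}_{d,n}$ with $\int_{\mathbb{R}^n}\exp(-f^\star(x))\,dx\le1$ and $\Vert f^\star\Vert=\mathrm{opt}^*_{\Vert\cdot\Vert}$. The orthogonal group $O(n)$ acts on $\mathcal{F}_{d,n}$ by $\rho^*f(x)=f(\rho^{-1}x)$; a norm on $\mathcal{F}_{d,n}$ is $O(n)$-invariant if $\Vert\rho^*f\Vert=\Vert f\Vert$ for all $\rho\in O(n)$ and $f\in\mathcal{F}_{d,n}$. *)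

theory Defs
  imports "HOL-Analysis.Analysis"
begin

definition multidegrees :: "nat \<Rightarrow> ('n::finite \<Rightarrow> nat) set" where
  "multidegrees d = {\<alpha>. (\<Sum>i\<in>UNIV. \<alpha> i) = d}"

lemma finite_multidegrees: "finite (multidegrees d :: ('n::finite \<Rightarrow> nat) set)"
proof (rule finite_subset)
  show "multidegrees d \<subseteq> (Pi\<^sub>E UNIV (\<lambda>_. {..d}) :: ('n \<Rightarrow> nat) set)"
    unfolding multidegrees_def by (auto intro: member_le_sum)
qed (intro finite_PiE; simp)

text \<open>A form is represented by its polynomial function; since the reals are infinite, this
  loses no information. The vector space operations are the pointwise ones.\<close>

definition forms :: "nat \<Rightarrow> (real^'n \<Rightarrow> real) set" where
  "forms d = {f. \<exists>c :: ('n \<Rightarrow> nat) \<Rightarrow> real.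
      \<forall>x. f x = (\<Sum>\<alpha>\<in>multidegrees d. c \<alpha> * (\<Prod>i\<in>UNIV. (x $ i) ^ \<alpha> i))}"

definition finite_volume_forms :: "nat \<Rightarrow> (real^'n \<Rightarrow> real) set" where
  "finite_volume_forms d = {f \<in> forms d. emeasure lborel {x. f x \<le> 1} < \<infinity>}"

text \<open>Values of \<open>N\<close> outside \<open>forms d\<close> are irrelevant throughout.\<close>

definition norm_on_forms :: "nat \<Rightarrow> ((real^'n \<Rightarrow> real) \<Rightarrow> real) \<Rightarrow> bool" where
  "norm_on_forms d N \<longleftrightarrow>
     (\<forall>f\<in>forms d. 0 \<le> N f) \<and>
     (\<forall>f\<in>forms d. N f = 0 \<longleftrightarrow> f = (\<lambda>x. 0)) \<and>
     (\<forall>f\<in>forms d. \<forall>c. N (\<lambda>x. c * f x) = \<bar>c\<bar> * N f) \<and>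
     (\<forall>f\<in>forms d. \<forall>g\<in>forms d. N (\<lambda>x. f x + g x) \<le> N f + N g)"

definition orthogonal_action ::
    "(real^'n \<Rightarrow> real^'n) \<Rightarrow> (real^'n \<Rightarrow> real) \<Rightarrow> (real^'n \<Rightarrow> real)" where
  "orthogonal_action \<rho> f = (\<lambda>x. f (inv \<rho> x))"

definition orthogonally_invariant :: "nat \<Rightarrow> ((real^'n \<Rightarrow> real) \<Rightarrow> real) \<Rightarrow> bool" where
  "orthogonally_invariant d N \<longleftrightarrow>
     (\<forall>\<rho>. orthogonal_transformation \<rho> \<longrightarrow>
        (\<forall>f\<in>forms d. N (orthogonal_action \<rho> f) = N f))"

definition feasible_forms :: "nat \<Rightarrow> (real^'n \<Rightarrow> real) set" where
  "feasible_forms d = {f \<in> forms d. (\<integral>\<^sup>+x. ennreal (exp (- f x)) \<partial>lborel) \<le> 1}"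

definition opt_value :: "nat \<Rightarrow> ((real^'n \<Rightarrow> real) \<Rightarrow> real) \<Rightarrow> real" where
  "opt_value d N = (INF f\<in>feasible_forms d. N f)"

definition optimal_solution ::
    "nat \<Rightarrow> ((real^'n \<Rightarrow> real) \<Rightarrow> real) \<Rightarrow> (real^'n \<Rightarrow> real) \<Rightarrow> bool" where
  "optimal_solution d N f \<longleftrightarrow> f \<in> feasible_forms d \<and> N f = opt_value d N"

definition ball_form :: "nat \<Rightarrow> real^'n \<Rightarrow> real" where
  "ball_form d x = norm x ^ d"

definition kappa :: "nat \<Rightarrow> nat \<Rightarrow> real" where
  "kappa d n =
     (Gamma (1 + real n / real d) / Gamma (1 + real n / 2)) powr (real d / real n)
       * pi powr (real d / 2)"

end

theory Submission imports Defs
begin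

text \<open>
Write \<open>I f\<close> for the integral of \<open>exp (- f)\<close>. Four properties of \<open>I\<close> on forms of degree \<open>d\<close> in \<open>n\<close>
variables carry the theorem: homogeneity, \<open>I (t f) = t\<^bsup>-n/d\<^esup> I f\<close> for \<open>t > 0\<close> (\<open>exp_integral_scale\<close>);
lower semicontinuity under pointwise limits, by Fatou's lemma (\<open>exp_integral_pointwise_limit\<close>);
strict convexity (\<open>exp_integral_midpoint_less\<close>); and invariance under the orthogonal group
(\<open>exp_integral_orthogonal\<close>).

A minimizing sequence is bounded in norm. The space of forms is finite-dimensional, so a subsequence
converges both in norm and pointwise (\<open>forms_over_bounded_subsequence\<close>), and its limit is feasible by
lower semicontinuity; hence a minimizer exists. It has finite volume because \<open>exp (- f) \<ge> exp (- 1)\<close>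
on the sublevel set. At a minimizer the constraint cannot be slack, since otherwise \<open>f\<close> could be
shrunk (\<open>opt_value_less_of_slack\<close>); but the midpoint of two distinct minimizers would have norm at
most the optimum and a slack constraint by strict convexity. So the minimizer is unique.

For an \<open>O(n)\<close>-invariant norm every rotation of the minimizer is again a minimizer, so by uniqueness
the minimizer is rotation invariant, and by homogeneity it is a multiple \<open>t |x|\<^sup>d\<close>. Such a multiple
is feasible exactly for \<open>t \<ge> \<kappa>\<close> (\<open>multiple_of_ball_form_feasible_iff\<close>), because
\<open>I (|x|\<^sup>d) = vol B * \<Gamma>(1 + n/d) = \<kappa>\<^bsup>n/d\<^esup>\<close>, where \<open>B\<close> is the unit ball; minimality then gives \<open>t = \<kappa>\<close>.
\<close>

section \<open>The algebra of forms\<close>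

definition monomial :: "('n::finite \<Rightarrow> nat) \<Rightarrow> real^'n \<Rightarrow> real" where
  "monomial \<alpha> x = (\<Prod>i\<in>UNIV. (x $ i) ^ \<alpha> i)"

text \<open>Arbitrary sets of exponents are allowed so that compactness can be proved
  by adding one monomial at a time.\<close>

definition forms_over :: "('n::finite \<Rightarrow> nat) set \<Rightarrow> (real^'n \<Rightarrow> real) set" where
  "forms_over J = {f. \<exists>c. \<forall>x. f x = (\<Sum>\<alpha>\<in>J. c \<alpha> * monomial \<alpha> x)}"

lemma forms_eq_forms_over: "forms d = forms_over (multidegrees d)"
  by (simp add: forms_def forms_over_def monomial_def)

lemma forms_overI: "(\<And>x. f x = (\<Sum>\<alpha>\<in>J. c \<alpha> * monomial \<alpha> x)) \<Longrightarrow> f \<in> forms_over J"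
  unfolding forms_over_def by blast

lemma forms_over_add:
  assumes "f \<in> forms_over J" "g \<in> forms_over J"
  shows "(\<lambda>x. f x + g x) \<in> forms_over J"
proof -
  obtain c e where "\<forall>x. f x = (\<Sum>\<alpha>\<in>J. c \<alpha> * monomial \<alpha> x)" "\<forall>x. g x = (\<Sum>\<alpha>\<in>J. e \<alpha> * monomial \<alpha> x)"
    using assms by (auto simp: forms_over_def)
  then have "\<forall>x. f x + g x = (\<Sum>\<alpha>\<in>J. (c \<alpha> + e \<alpha>) * monomial \<alpha> x)"
    by (simp add: sum.distrib distrib_right)
  then show ?thesis by (intro forms_overI[where c = "\<lambda>\<alpha>. c \<alpha> + e \<alpha>"]) simp
qed

lemma forms_over_cmult:
  assumes "f \<in> forms_over J"
  shows "(\<lambda>x. a * f x) \<in> forms_over J"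
proof -
  obtain c where "\<forall>x. f x = (\<Sum>\<alpha>\<in>J. c \<alpha> * monomial \<alpha> x)"
    using assms by (auto simp: forms_over_def)
  then have "\<forall>x. a * f x = (\<Sum>\<alpha>\<in>J. (a * c \<alpha>) * monomial \<alpha> x)"
    by (simp add: sum_distrib_left mult.assoc)
  then show ?thesis by (intro forms_overI[where c = "\<lambda>\<alpha>. a * c \<alpha>"]) simp
qed

lemma forms_over_mono:
  assumes "f \<in> forms_over J" "J \<subseteq> K" "finite K"
  shows "f \<in> forms_over K"
proof -
  obtain c where c: "\<forall>x. f x = (\<Sum>\<alpha>\<in>J. c \<alpha> * monomial \<alpha> x)"
    using assms by (auto simp: forms_over_def)
  have "(\<Sum>\<alpha>\<in>J. c \<alpha> * monomial \<alpha> x) = (\<Sum>\<alpha>\<in>K. (if \<alpha> \<in> J then c \<alpha> else 0) * monomial \<alpha> x)" for x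
    using assms(2,3) by (intro sum.mono_neutral_cong_left) auto
  with c show ?thesis
    unfolding forms_over_def by (intro CollectI exI[of _ "\<lambda>\<alpha>. if \<alpha> \<in> J then c \<alpha> else 0"]) simp
qed

lemma monomial_in_forms_over: "monomial \<alpha> \<in> forms_over {\<alpha>}"
  unfolding forms_over_def by (auto intro: exI[of _ "\<lambda>_. 1"])

lemma forms_over_insert:
  assumes "f \<in> forms_over (insert \<beta> J)" "finite J" "\<beta> \<notin> J"
  obtains g a where "g \<in> forms_over J" "f = (\<lambda>x. g x + a * monomial \<beta> x)"
proof -
  obtain c where c: "\<forall>x. f x = (\<Sum>\<alpha>\<in>insert \<beta> J. c \<alpha> * monomial \<alpha> x)"
    using assms by (auto simp: forms_over_def)
  show thesis
  proof
    show "(\<lambda>x. \<Sum>\<alpha>\<in>J. c \<alpha> * monomial \<alpha> x) \<in> forms_over J"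
      unfolding forms_over_def by blast
    show "f = (\<lambda>x. (\<Sum>\<alpha>\<in>J. c \<alpha> * monomial \<alpha> x) + c \<beta> * monomial \<beta> x)"
      using c assms(2,3) by (auto simp: fun_eq_iff)
  qed
qed

lemma forms_add: "f \<in> forms d \<Longrightarrow> g \<in> forms d \<Longrightarrow> (\<lambda>x. f x + g x) \<in> forms d"
  unfolding forms_eq_forms_over by (rule forms_over_add)

lemma forms_cmult: "f \<in> forms d \<Longrightarrow> (\<lambda>x. a * f x) \<in> forms d"
  unfolding forms_eq_forms_over by (rule forms_over_cmult)

lemma forms_zero: "(\<lambda>x. 0) \<in> forms d"
  unfolding forms_eq_forms_over forms_over_def by (auto intro: exI[of _ "\<lambda>_. 0"])

lemma forms_sum:
  "(\<And>i. i \<in> A \<Longrightarrow> f i \<in> forms d) \<Longrightarrow> (\<lambda>x. \<Sum>i\<in>A. f i x) \<in> forms d"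
  by (induction A rule: infinite_finite_induct) (auto intro: forms_zero forms_add)

lemma forms_diff:
  assumes "f \<in> forms d" "g \<in> forms d"
  shows "(\<lambda>x. f x - g x) \<in> forms d"
  using forms_add[OF assms(1) forms_cmult[OF assms(2), of "-1"]] by simp

lemma monomial_in_forms: "\<alpha> \<in> multidegrees d \<Longrightarrow> monomial \<alpha> \<in> forms d"
  unfolding forms_eq_forms_over
  by (rule forms_over_mono[OF monomial_in_forms_over]) (auto intro: finite_multidegrees)

lemma forms_mult:
  assumes "f \<in> forms a" "g \<in> forms b"
  shows "(\<lambda>x. f x * g x) \<in> forms (a + b)"
proof -
  obtain c e where f: "\<And>x. f x = (\<Sum>\<alpha>\<in>multidegrees a. c \<alpha> * monomial \<alpha> x)"
      and g: "\<And>x. g x = (\<Sum>\<beta>\<in>multidegrees b. e \<beta> * monomial \<beta> x)"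
    using assms unfolding forms_eq_forms_over forms_over_def by blast
  have "(\<lambda>x. \<Sum>\<alpha>\<in>multidegrees a. \<Sum>\<beta>\<in>multidegrees b.
      (c \<alpha> * e \<beta>) * monomial (\<lambda>i. \<alpha> i + \<beta> i) x) \<in> forms (a + b)"
    by (intro forms_sum forms_cmult monomial_in_forms) (auto simp: multidegrees_def sum.distrib)
  also have "(\<lambda>x. \<Sum>\<alpha>\<in>multidegrees a. \<Sum>\<beta>\<in>multidegrees b.
      (c \<alpha> * e \<beta>) * monomial (\<lambda>i. \<alpha> i + \<beta> i) x) = (\<lambda>x. f x * g x)"
    by (simp add: fun_eq_iff f g sum_product monomial_def power_add prod.distrib mult_ac)
  finally show ?thesis .
qed

lemma forms_one: "(\<lambda>x. 1) \<in> forms 0"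
  using monomial_in_forms[of "\<lambda>_. 0" 0] by (simp add: multidegrees_def monomial_def[abs_def])

lemma forms_power: "f \<in> forms a \<Longrightarrow> (\<lambda>x. f x ^ k) \<in> forms (k * a)"
  by (induction k) (auto intro: forms_one forms_mult)

lemma forms_prod:
  "finite A \<Longrightarrow> (\<And>i. i \<in> A \<Longrightarrow> f i \<in> forms (e i)) \<Longrightarrow> (\<lambda>x. \<Prod>i\<in>A. f i x) \<in> forms (sum e A)"
  by (induction A rule: finite_induct) (auto intro: forms_one forms_mult)

lemma coordinate_in_forms: "(\<lambda>x :: real^'n. x $ j) \<in> forms 1"
proof -
  have "(\<lambda>i. if i = j then 1 else 0) \<in> multidegrees 1"
    by (simp add: multidegrees_def)
  moreover have "monomial (\<lambda>i. if i = j then 1 else 0) = (\<lambda>x :: real^'n. x $ j)"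
    by (simp add: fun_eq_iff monomial_def if_distrib cong: if_cong)
  ultimately show ?thesis by (metis monomial_in_forms)
qed

lemma forms_linear_comp:
  fixes f :: "real^'n \<Rightarrow> real" and L :: "real^'n \<Rightarrow> real^'n"
  assumes "f \<in> forms d" "linear L"
  shows "(\<lambda>x. f (L x)) \<in> forms d"
proof -
  obtain c where f: "\<And>x. f x = (\<Sum>\<alpha>\<in>multidegrees d. c \<alpha> * monomial \<alpha> x)"
    using assms unfolding forms_eq_forms_over forms_over_def by blast
  have coord: "(\<lambda>x. L x $ i) \<in> forms 1" for i
  proof -
    have "(\<lambda>x. L x $ i) = (\<lambda>x. \<Sum>j\<in>UNIV. L (axis j 1) $ i * x $ j)"
    proof
      fix x
      have "L x = L (\<Sum>j\<in>UNIV. x $ j *\<^sub>R axis j 1)"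
        using basis_expansion[of x] by (simp only: scalar_mult_eq_scaleR)
      also have "\<dots> = (\<Sum>j\<in>UNIV. x $ j *\<^sub>R L (axis j 1))"
        by (simp only: linear_sum[OF assms(2)] linear_scale[OF assms(2)])
      finally show "L x $ i = (\<Sum>j\<in>UNIV. L (axis j 1) $ i * x $ j)"
        by (simp add: mult.commute)
    qed
    also have "\<dots> \<in> forms 1"
      by (intro forms_sum forms_cmult coordinate_in_forms)
    finally show ?thesis .
  qed
  have "(\<lambda>x. monomial \<alpha> (L x)) \<in> forms d" if "\<alpha> \<in> multidegrees d" for \<alpha>
  proof -
    have "(\<lambda>x. \<Prod>i\<in>UNIV. (L x $ i) ^ \<alpha> i) \<in> forms (\<Sum>i\<in>UNIV. \<alpha> i)"
      using forms_power[OF coord] by (intro forms_prod) auto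
    with that show ?thesis by (simp add: multidegrees_def monomial_def)
  qed
  then have "(\<lambda>x. \<Sum>\<alpha>\<in>multidegrees d. c \<alpha> * monomial \<alpha> (L x)) \<in> forms d"
    by (intro forms_sum forms_cmult) auto
  then show ?thesis by (simp add: f)
qed

lemma forms_homogeneous:
  assumes "f \<in> forms d"
  shows "f (s *\<^sub>R x) = s ^ d * f x"
proof -
  obtain c where f: "\<And>x. f x = (\<Sum>\<alpha>\<in>multidegrees d. c \<alpha> * monomial \<alpha> x)"
    using assms unfolding forms_eq_forms_over forms_over_def by blast
  have "monomial \<alpha> (s *\<^sub>R x) = s ^ d * monomial \<alpha> x" if "\<alpha> \<in> multidegrees d" for \<alpha>
    using that by (simp add: monomial_def power_mult_distrib prod.distrib multidegrees_def flip: power_sum)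
  then show ?thesis by (simp add: f sum_distrib_left algebra_simps)
qed

lemma continuous_on_form:
  assumes "f \<in> forms d"
  shows "continuous_on UNIV f"
proof -
  obtain c where f: "\<And>x. f x = (\<Sum>\<alpha>\<in>multidegrees d. c \<alpha> * monomial \<alpha> x)"
    using assms unfolding forms_eq_forms_over forms_over_def by blast
  show ?thesis
    unfolding f monomial_def by (intro continuous_intros)
qed

lemma borel_measurable_form: "f \<in> forms d \<Longrightarrow> f \<in> borel_measurable borel"
  by (intro borel_measurable_continuous_onI continuous_on_form)

lemma ball_form_in_forms:
  assumes "even d"
  shows "ball_form d \<in> (forms d :: (real^'n \<Rightarrow> real) set)"
proof -
  have "(\<lambda>x :: real^'n. (\<Sum>i\<in>UNIV. (x $ i) ^ 2) ^ (d div 2)) \<in> forms (d div 2 * 2)"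
    using forms_power[OF coordinate_in_forms] by (intro forms_power forms_sum) simp
  moreover have "(\<Sum>i\<in>UNIV. (x $ i) ^ 2) ^ (d div 2) = ball_form d x" for x :: "real^'n"
  proof -
    have "(\<Sum>i\<in>UNIV. (x $ i) ^ 2) = norm x ^ 2"
      by (simp add: norm_vec_def L2_set_def sum_nonneg)
    then show ?thesis
      using assms by (simp add: ball_form_def flip: power_mult)
  qed
  ultimately show ?thesis using assms by simp
qed

section \<open>Compactness for a norm on forms\<close>

lemma norm_on_forms_nonneg: "norm_on_forms d N \<Longrightarrow> f \<in> forms d \<Longrightarrow> 0 \<le> N f"
  and norm_on_forms_eq_0: "norm_on_forms d N \<Longrightarrow> f \<in> forms d \<Longrightarrow> N f = 0 \<longleftrightarrow> f = (\<lambda>x. 0)"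
  and norm_on_forms_cmult: "norm_on_forms d N \<Longrightarrow> f \<in> forms d \<Longrightarrow> N (\<lambda>x. c * f x) = \<bar>c\<bar> * N f"
  and norm_on_forms_triangle:
    "norm_on_forms d N \<Longrightarrow> f \<in> forms d \<Longrightarrow> g \<in> forms d \<Longrightarrow> N (\<lambda>x. f x + g x) \<le> N f + N g"
  unfolding norm_on_forms_def by blast+

lemma norm_on_forms_diff_commute:
  assumes "norm_on_forms d N" "f \<in> forms d" "g \<in> forms d"
  shows "N (\<lambda>x. f x - g x) = N (\<lambda>x. g x - f x)"
  using norm_on_forms_cmult[OF assms(1) forms_diff[OF assms(2,3)], of "-1"] by simp

text \<open>In a finite-dimensional normed space bounded sequences have convergent subsequences.
  The induction adds one monomial at a time. If the new monomial is not a combination of the old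
  ones, then it has positive distance from their span (the span is closed, by the induction
  hypothesis), so in a bounded sequence both its coefficient and the remaining part stay bounded.
  Pointwise convergence is carried along because the integrals need it.\<close>

lemma forms_over_bounded_subsequence:
  fixes f :: "nat \<Rightarrow> real^'n \<Rightarrow> real"
  assumes N: "norm_on_forms d N" and "J \<subseteq> multidegrees d"
    and "\<And>k. f k \<in> forms_over J" and "\<And>k. N (f k) \<le> B"
  shows "\<exists>r l. strict_mono r \<and> l \<in> forms_over J \<and> (\<lambda>k. N (\<lambda>x. f (r k) x - l x)) \<longlonglongrightarrow> 0 \<and>
           (\<forall>x. (\<lambda>k. f (r k) x) \<longlonglongrightarrow> l x)"
proof -
  have "finite J" using assms(2) finite_multidegrees finite_subset by blast
  then show ?thesis using assms(2-4)
  proof (induction J arbitrary: f B rule: finite_induct)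
    case empty
    then have "f k = (\<lambda>x. 0)" for k by (auto simp: forms_over_def fun_eq_iff)
    moreover have "N (\<lambda>x. 0) = 0" using norm_on_forms_eq_0[OF N forms_zero] by simp
    ultimately show ?case
      by (intro exI[of _ id] exI[of _ "\<lambda>x. 0"]) (auto simp: forms_over_def strict_mono_def)
  next
    case (insert \<beta> J)
    have J: "J \<subseteq> multidegrees d" and \<beta>: "monomial \<beta> \<in> forms d"
      using insert.prems(1) monomial_in_forms by auto
    have sub: "g \<in> forms d" if "g \<in> forms_over J" for g
      using forms_over_mono[OF that J finite_multidegrees] by (simp add: forms_eq_forms_over)
    have sub': "g \<in> forms_over (insert \<beta> J)" if "g \<in> forms_over J" for g
      using forms_over_mono[OF that, of "insert \<beta> J"] insert.hyps by auto
    have \<beta>': "monomial \<beta> \<in> forms_over (insert \<beta> J)"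
      by (rule forms_over_mono[OF monomial_in_forms_over]) (use insert.hyps in auto)
    have "\<exists>g a. g \<in> forms_over J \<and> f k = (\<lambda>x. g x + a * monomial \<beta> x)" for k
      using forms_over_insert[OF insert.prems(2)[of k] insert.hyps(1,2)] by metis
    then obtain g a where g: "\<And>k. g k \<in> forms_over J"
        and fk: "\<And>k. f k = (\<lambda>x. g k x + a k * monomial \<beta> x)" by metis
    show ?case
    proof (cases "monomial \<beta> \<in> forms_over J")
      case True
      have fJ: "f k \<in> forms_over J" for k
        unfolding fk by (intro forms_over_add forms_over_cmult g True)
      obtain r l where "strict_mono r" and l: "l \<in> forms_over J"
          and "(\<lambda>k. N (\<lambda>x. f (r k) x - l x)) \<longlonglongrightarrow> 0" "\<forall>x. (\<lambda>k. f (r k) x) \<longlonglongrightarrow> l x"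
        using insert.IH[of f, OF J fJ insert.prems(3)] by (elim exE conjE) (rule that; assumption)
      with sub'[OF l] show ?thesis by - (rule exI[of _ r], rule exI[of _ l], intro conjI; assumption)
    next
      case False
      \<comment> \<open>A sequence in the old span approaching the negative of the new monomial is bounded; by the
        induction hypothesis it subconverges in the old span, which would contain the new monomial.\<close>
      have "\<exists>\<delta>>0. \<forall>v\<in>forms_over J. \<delta> \<le> N (\<lambda>x. v x + monomial \<beta> x)"
      proof (rule ccontr)
        assume "\<not> ?thesis"
        then have "\<forall>k. \<exists>v\<in>forms_over J. N (\<lambda>x. v x + monomial \<beta> x) < inverse (real (Suc k))"
          by (meson not_le inverse_positive_iff_positive of_nat_0_less_iff zero_less_Suc)
        then obtain v where v: "\<And>k. v k \<in> forms_over J"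
            and vN: "\<And>k. N (\<lambda>x. v k x + monomial \<beta> x) < inverse (real (Suc k))" by metis
        have "N (v k) \<le> 1 + N (monomial \<beta>)" for k
        proof -
          have "N (\<lambda>x. (v k x + monomial \<beta> x) + -1 * monomial \<beta> x)
              \<le> N (\<lambda>x. v k x + monomial \<beta> x) + N (\<lambda>x. -1 * monomial \<beta> x)"
            by (rule norm_on_forms_triangle[OF N]) (intro forms_add forms_cmult sub v \<beta>)+
          then have "N (v k) \<le> N (\<lambda>x. v k x + monomial \<beta> x) + N (monomial \<beta>)"
            using norm_on_forms_cmult[OF N \<beta>, of "-1"] by simp
          moreover have "inverse (real (Suc k)) \<le> 1" by (simp add: inverse_le_1_iff)
          ultimately show ?thesis using vN[of k] by linarith
        qed
        from insert.IH[of v, OF J v this] obtain r l where r: "strict_mono r" "l \<in> forms_over J"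
          and lim: "(\<lambda>k. N (\<lambda>x. v (r k) x - l x)) \<longlonglongrightarrow> 0"
          by (elim exE conjE) (rule that; assumption)
        have le: "N (\<lambda>x. l x + monomial \<beta> x) \<le> inverse (real (Suc (r k))) + N (\<lambda>x. v (r k) x - l x)" for k
        proof -
          have "N (\<lambda>x. (v (r k) x + monomial \<beta> x) + (l x - v (r k) x))
              \<le> N (\<lambda>x. v (r k) x + monomial \<beta> x) + N (\<lambda>x. l x - v (r k) x)"
            by (intro norm_on_forms_triangle[OF N] forms_add forms_diff sub v \<beta> r)
          then show ?thesis
            using vN[of "r k"] norm_on_forms_diff_commute[OF N sub[OF v] sub[OF r(2)], of "r k"]
            by (simp add: algebra_simps)
        qed
        have "(\<lambda>k. inverse (real (Suc (r k))) + N (\<lambda>x. v (r k) x - l x)) \<longlonglongrightarrow> 0 + 0"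
          by (intro tendsto_add lim)
             (use LIMSEQ_subseq_LIMSEQ[OF LIMSEQ_inverse_real_of_nat r(1)] in \<open>simp add: o_def\<close>)
        then have "N (\<lambda>x. l x + monomial \<beta> x) \<le> 0"
          using le by (intro LIMSEQ_le_const) auto
        then have "(\<lambda>x. l x + monomial \<beta> x) = (\<lambda>x. 0)"
          using norm_on_forms_nonneg[OF N forms_add[OF sub[OF r(2)] \<beta>]]
            norm_on_forms_eq_0[OF N forms_add[OF sub[OF r(2)] \<beta>]] by linarith
        then have "monomial \<beta> = (\<lambda>x. -1 * l x)"
          by (simp add: fun_eq_iff add_eq_0_iff)
        with False forms_over_cmult[OF r(2), of "-1"] show False by simp
      qed
      then obtain \<delta> where \<delta>: "\<delta> > 0"
        and dist: "\<And>v. v \<in> forms_over J \<Longrightarrow> \<delta> \<le> N (\<lambda>x. v x + monomial \<beta> x)" by blast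
      have a_bound: "\<bar>a k\<bar> \<le> B / \<delta>" for k
      proof (cases "a k = 0")
        case True
        have "0 \<le> N (f k)" unfolding fk
          by (intro norm_on_forms_nonneg[OF N] forms_add forms_cmult sub g \<beta>)
        with True \<delta> insert.prems(3)[of k] show ?thesis by simp
      next
        case False
        \<comment> \<open>Dividing \<open>f k\<close> by \<open>a k\<close> gives the new monomial plus an element of the old span.\<close>
        let ?v = "\<lambda>x. inverse (a k) * g k x"
        have v: "?v \<in> forms_over J" by (intro forms_over_cmult g)
        have "N (\<lambda>x. a k * (?v x + monomial \<beta> x)) = \<bar>a k\<bar> * N (\<lambda>x. ?v x + monomial \<beta> x)"
          by (intro norm_on_forms_cmult[OF N] forms_add sub v \<beta>)
        moreover have "(\<lambda>x. a k * (?v x + monomial \<beta> x)) = f k"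
          using False by (simp add: fk fun_eq_iff algebra_simps)
        ultimately have "\<bar>a k\<bar> * \<delta> \<le> N (f k)"
          using dist[OF v] by (simp add: mult_left_mono)
        then show ?thesis using \<delta> insert.prems(3)[of k] by (simp add: field_simps)
      qed
      have g_bound: "N (g k) \<le> B + B / \<delta> * N (monomial \<beta>)" for k
      proof -
        have "N (\<lambda>x. f k x + - a k * monomial \<beta> x) \<le> N (f k) + N (\<lambda>x. - a k * monomial \<beta> x)"
          unfolding fk by (intro norm_on_forms_triangle[OF N] forms_add forms_cmult sub g \<beta>)
        then have "N (g k) \<le> N (f k) + \<bar>a k\<bar> * N (monomial \<beta>)"
          using norm_on_forms_cmult[OF N \<beta>, of "- a k"] by (simp add: fk)
        then show ?thesis
          using insert.prems(3)[of k] mult_right_mono[OF a_bound norm_on_forms_nonneg[OF N \<beta>], of k]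
          by linarith
      qed
      have "bounded (range a)" using a_bound by (auto simp: bounded_iff)
      then obtain r1 A where r1: "strict_mono r1" and A: "(a \<circ> r1) \<longlonglongrightarrow> A"
        using bounded_imp_convergent_subsequence by blast
      obtain r2 l where r2: "strict_mono r2" and l: "l \<in> forms_over J"
          and lN: "(\<lambda>k. N (\<lambda>x. g (r1 (r2 k)) x - l x)) \<longlonglongrightarrow> 0"
          and lx: "\<forall>x. (\<lambda>k. g (r1 (r2 k)) x) \<longlonglongrightarrow> l x"
        using insert.IH[of "\<lambda>k. g (r1 k)", OF J g g_bound] by (elim exE conjE) (rule that; assumption)
      have A': "(\<lambda>k. a (r1 (r2 k))) \<longlonglongrightarrow> A"
        using LIMSEQ_subseq_LIMSEQ[OF A r2] by (simp add: o_def)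
      let ?l = "\<lambda>x. l x + A * monomial \<beta> x"
      let ?r = "\<lambda>k. r1 (r2 k)"
      show ?thesis
      proof (intro exI conjI allI)
        show "strict_mono ?r" using r1 r2 by (simp add: strict_mono_def)
        show "?l \<in> forms_over (insert \<beta> J)"
          by (intro forms_over_add forms_over_cmult sub' l \<beta>')
        show "(\<lambda>k. f (?r k) x) \<longlonglongrightarrow> ?l x" for x
          unfolding fk
          by (rule tendsto_add[OF lx[rule_format] tendsto_mult[OF A' tendsto_const]])
        have l_in: "?l \<in> forms d" by (intro forms_add forms_cmult sub l \<beta>)
        have f_in: "f k \<in> forms d" for k
          unfolding fk by (intro forms_add forms_cmult sub g \<beta>)
        have ub: "N (\<lambda>x. f (?r k) x - ?l x)
            \<le> N (\<lambda>x. g (?r k) x - l x) + \<bar>a (?r k) - A\<bar> * N (monomial \<beta>)" for k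
        proof -
          have "N (\<lambda>x. (g (?r k) x - l x) + (a (?r k) - A) * monomial \<beta> x)
              \<le> N (\<lambda>x. g (?r k) x - l x) + N (\<lambda>x. (a (?r k) - A) * monomial \<beta> x)"
            by (intro norm_on_forms_triangle[OF N] forms_diff forms_cmult sub g l \<beta>)
          moreover have "(\<lambda>x. (g (?r k) x - l x) + (a (?r k) - A) * monomial \<beta> x)
              = (\<lambda>x. f (?r k) x - ?l x)"
            by (simp add: fk algebra_simps)
          ultimately show ?thesis
            by (simp only: norm_on_forms_cmult[OF N \<beta>])
        qed
        have lb: "0 \<le> N (\<lambda>x. f (?r k) x - ?l x)" for k
          by (rule norm_on_forms_nonneg[OF N forms_diff[OF f_in l_in]])
        have "(\<lambda>k. N (\<lambda>x. g (?r k) x - l x) + \<bar>a (?r k) - A\<bar> * N (monomial \<beta>))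
            \<longlonglongrightarrow> 0 + \<bar>A - A\<bar> * N (monomial \<beta>)"
          by (rule tendsto_add[OF lN tendsto_mult[OF tendsto_rabs[OF tendsto_diff[OF A' tendsto_const]]
                tendsto_const]])
        then have ub_lim: "(\<lambda>k. N (\<lambda>x. g (?r k) x - l x) + \<bar>a (?r k) - A\<bar> * N (monomial \<beta>))
            \<longlonglongrightarrow> 0" by simp
        show "(\<lambda>k. N (\<lambda>x. f (?r k) x - ?l x)) \<longlonglongrightarrow> 0"
          by (rule tendsto_sandwich[OF always_eventually[OF allI[OF lb]]
                always_eventually[OF allI[OF ub]] tendsto_const ub_lim])
      qed
    qed
  qed
qed

section \<open>The integral of \<open>exp (- f)\<close>\<close>

definition exp_integral :: "(real^'n \<Rightarrow> real) \<Rightarrow> ennreal" where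
  "exp_integral f = (\<integral>\<^sup>+x. ennreal (exp (- f x)) \<partial>lborel)"

lemma feasible_forms_iff: "f \<in> feasible_forms d \<longleftrightarrow> f \<in> forms d \<and> exp_integral f \<le> 1"
  by (simp add: feasible_forms_def exp_integral_def)

text \<open>Substituting \<open>x = t\<^bsup>1/d\<^esup> y\<close> turns \<open>f\<close> into \<open>t f\<close> by homogeneity, with Jacobian \<open>t\<^bsup>n/d\<^esup>\<close>.\<close>

lemma exp_integral_scale:
  fixes f :: "real^'n \<Rightarrow> real"
  assumes f: "f \<in> forms d" and "d > 0" "t > 0"
  shows "exp_integral f = ennreal (t powr (CARD('n) / d)) * exp_integral (\<lambda>x. t * f x)"
proof -
  define s where "s = t powr (1 / d)"
  have s: "s > 0" using assms by (simp add: s_def)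
  have sd: "s ^ d = t"
    using assms by (simp add: s_def powr_powr flip: powr_realpow)
  have sn: "s ^ CARD('n) = t powr (CARD('n) / d)"
    using assms by (simp add: s_def powr_powr flip: powr_realpow)
  have [measurable]: "f \<in> borel_measurable borel" using f by (rule borel_measurable_form)
  have "exp_integral f =
      (\<integral>\<^sup>+x. ennreal (exp (- f x)) \<partial>density (distr lborel borel (\<lambda>x. 0 + s *\<^sub>R x)) (\<lambda>_. \<bar>s\<bar>^DIM(real^'n)))"
    unfolding exp_integral_def using s by (subst lborel_affine[of s 0]) auto
  also have "\<dots> = (\<integral>\<^sup>+x. ennreal (s ^ CARD('n)) * ennreal (exp (- f (s *\<^sub>R x))) \<partial>lborel)"
    using s by (simp add: nn_integral_density nn_integral_distr)
  also have "\<dots> = ennreal (s ^ CARD('n)) * exp_integral (\<lambda>x. t * f x)"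
    by (simp add: nn_integral_cmult exp_integral_def forms_homogeneous[OF f] sd)
  finally show ?thesis by (simp add: sn)
qed

lemma exp_integral_nonpos:
  fixes f :: "real^'n \<Rightarrow> real"
  assumes "\<And>x. f x \<le> 0"
  shows "exp_integral f = \<infinity>"
proof -
  have "\<infinity> = (\<integral>\<^sup>+x. 1 \<partial>(lborel :: (real^'n) measure))" by simp
  also have "\<dots> \<le> exp_integral f"
    unfolding exp_integral_def using assms by (intro nn_integral_mono) (simp flip: ennreal_1)
  finally show ?thesis by (simp add: top.extremum_unique)
qed

text \<open>Layer-cake: \<open>exp (- |x|\<^sup>d)\<close> is the integral of \<open>exp (- t)\<close> over \<open>t \<ge> |x|\<^sup>d\<close>, and exchanging
  the integrals leaves the volumes of the balls of radius \<open>t\<^bsup>1/d\<^esup>\<close>, hence a Gamma integral.\<close>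

lemma exp_integral_ball_form:
  assumes "d > 0"
  shows "exp_integral (ball_form d :: real^'n \<Rightarrow> real) =
    ennreal (unit_ball_vol CARD('n) * Gamma (1 + CARD('n) / d))"
proof -
  let ?n = "real CARD('n)"
  have tail: "ennreal (exp (- a)) = (\<integral>\<^sup>+t. ennreal (exp (- t)) * indicator {a..} t \<partial>lborel)" for a :: real
  proof -
    have "((\<lambda>t::real. - exp (- t)) \<longlongrightarrow> - 0) at_top"
      by (intro tendsto_minus filterlim_compose[OF exp_at_bot filterlim_uminus_at_bot_at_top])
    then have "(\<integral>\<^sup>+t. ennreal (exp (- t)) * indicator {a..} t \<partial>lborel) = 0 - (- exp (- a))"
      by (intro nn_integral_FTC_atLeast) (auto intro!: derivative_eq_intros)
    then show ?thesis by simp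
  qed
  have sublevel: "emeasure lborel {x :: real^'n. norm x ^ d \<le> t}
      = ennreal (unit_ball_vol ?n * t powr (?n / d))" if "t \<ge> 0" for t
  proof -
    have "norm x ^ d \<le> t \<longleftrightarrow> norm x \<le> t powr (1 / d)" for x :: "real^'n"
    proof -
      have "(t powr (1 / d)) ^ d = t"
        using assms that by (cases "t = 0") (simp_all add: powr_powr flip: powr_realpow)
      then show ?thesis
        using assms power_mono_iff[of "norm x" "t powr (1 / d)" d] by simp
    qed
    then have "{x :: real^'n. norm x ^ d \<le> t} = cball 0 (t powr (1 / d))"
      by (simp add: set_eq_iff)
    moreover have "(t powr (1 / d)) ^ CARD('n) = t powr (?n / d)"
      using assms that by (cases "t = 0") (simp_all add: powr_powr flip: powr_realpow)
    ultimately show ?thesis by (simp add: emeasure_cball)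
  qed
  have "exp_integral (ball_form d :: real^'n \<Rightarrow> real) =
      (\<integral>\<^sup>+x. \<integral>\<^sup>+t. ennreal (exp (- t)) * indicator {norm (x :: real^'n) ^ d..} t \<partial>lborel \<partial>lborel)"
    unfolding exp_integral_def ball_form_def by (intro nn_integral_cong tail)
  also have "\<dots> = (\<integral>\<^sup>+t. \<integral>\<^sup>+x. ennreal (exp (- t)) * indicator {norm (x :: real^'n) ^ d..} t \<partial>lborel \<partial>lborel)"
    by (rule lborel_pair.Fubini') (simp add: indicator_def)
  also have "\<dots> = (\<integral>\<^sup>+t. ennreal (unit_ball_vol ?n) *
      ennreal (indicator {0..} t * t powr ((1 + ?n / d) - 1) / exp t) \<partial>lborel)"
  proof (rule nn_integral_cong)
    fix t :: real
    have "(\<integral>\<^sup>+x. ennreal (exp (- t)) * indicator {norm (x :: real^'n) ^ d..} t \<partial>lborel)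
        = (\<integral>\<^sup>+x. ennreal (exp (- t)) * indicator {x :: real^'n. norm x ^ d \<le> t} x \<partial>lborel)"
      by (intro nn_integral_cong) (simp add: indicator_def)
    also have "\<dots> = ennreal (exp (- t)) * emeasure lborel {x :: real^'n. norm x ^ d \<le> t}"
      by (intro nn_integral_cmult_indicator) simp
    also have "\<dots> = ennreal (unit_ball_vol ?n) *
        ennreal (indicator {0..} t * t powr ((1 + ?n / d) - 1) / exp t)"
    proof (cases "t \<ge> 0")
      case True
      then show ?thesis
        by (simp add: sublevel exp_minus divide_inverse mult_ac flip: ennreal_mult)
    next
      case False
      then have "{x :: real^'n. norm x ^ d \<le> t} = {}"
        by (auto simp: not_le intro: less_le_trans[of t 0])
      with False show ?thesis by simp
    qed
    finally show "(\<integral>\<^sup>+x. ennreal (exp (- t)) * indicator {norm (x :: real^'n) ^ d..} t \<partial>lborel)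
      = ennreal (unit_ball_vol ?n) * ennreal (indicator {0..} t * t powr ((1 + ?n / d) - 1) / exp t)" .
  qed
  also have "\<dots> = ennreal (unit_ball_vol ?n) * ennreal (Gamma (1 + ?n / d))"
    by (subst nn_integral_cmult) (simp_all add: Gamma_conv_nn_integral_real add_pos_nonneg)
  also have "\<dots> = ennreal (unit_ball_vol ?n * Gamma (1 + ?n / d))"
    by (simp add: ennreal_mult')
  finally show ?thesis .
qed

lemma kappa_pos:
  assumes "d > 0" "n > 0"
  shows "kappa d n > 0"
proof -
  have "Gamma (1 + real n / real d) / Gamma (1 + real n / 2) > 0"
    by (intro divide_pos_pos Gamma_real_pos add_pos_nonneg) auto
  then show ?thesis
    unfolding kappa_def by (intro mult_pos_pos) (simp_all only: powr_gt_zero, auto)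
qed

text \<open>Where \<open>\<kappa>\<close> comes from: its power \<open>n/d\<close> is the integral for \<open>|x|\<^sup>d\<close>, which scaling by \<open>\<kappa>\<close>
  therefore brings to exactly \<open>1\<close>.\<close>

lemma kappa_powr:
  assumes "d > 0" "n > 0"
  shows "kappa d n powr (n / d) = unit_ball_vol n * Gamma (1 + n / d)"
proof -
  have "Gamma (1 + real n / real d) > 0" "Gamma (1 + real n / 2) > 0"
    by (intro Gamma_real_pos add_pos_nonneg; simp)+
  with assms show ?thesis
    by (simp add: kappa_def unit_ball_vol_def powr_mult powr_powr add.commute)
qed

lemma exp_integral_multiple_of_ball_form:
  assumes "d > 0" "even d" "t > 0"
  shows "exp_integral (\<lambda>x :: real^'n. t * ball_form d x) =
    ennreal ((kappa d CARD('n) / t) powr (CARD('n) / d))"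
proof -
  let ?e = "real CARD('n) / d"
  have "ennreal (kappa d CARD('n) powr ?e)
      = ennreal (t powr ?e) * exp_integral (\<lambda>x :: real^'n. t * ball_form d x)"
    using exp_integral_scale[OF ball_form_in_forms[OF assms(2), where 'n = 'n] assms(1,3)]
      exp_integral_ball_form[OF assms(1), where 'n = 'n] kappa_powr[OF assms(1), of "CARD('n)"]
    by simp
  then have "ennreal (inverse (t powr ?e)) * ennreal (kappa d CARD('n) powr ?e)
      = ennreal (inverse (t powr ?e)) * ennreal (t powr ?e) * exp_integral (\<lambda>x :: real^'n. t * ball_form d x)"
    by (simp add: mult.assoc)
  moreover have "ennreal (inverse (t powr ?e)) * ennreal (t powr ?e) = 1"
    using assms(3) by (simp flip: ennreal_mult)
  moreover have "inverse (t powr ?e) * kappa d CARD('n) powr ?e = (kappa d CARD('n) / t) powr ?e"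
    using assms(3) kappa_pos[OF assms(1), of "CARD('n)"]
    by (subst powr_divide) (simp_all add: field_simps)
  ultimately show ?thesis by (simp flip: ennreal_mult)
qed

lemma multiple_of_ball_form_feasible_iff:
  assumes "d > 0" "even d"
  shows "(\<lambda>x :: real^'n. t * ball_form d x) \<in> feasible_forms d \<longleftrightarrow> kappa d CARD('n) \<le> t"
proof (cases "t > 0")
  case True
  let ?e = "real CARD('n) / d" and ?\<kappa> = "kappa d CARD('n)"
  have e: "?e > 0" using assms by simp
  have "(?\<kappa> / t) powr ?e \<le> 1 powr ?e \<longleftrightarrow> ?\<kappa> / t \<le> 1"
  proof
    assume "(?\<kappa> / t) powr ?e \<le> 1 powr ?e"
    then show "?\<kappa> / t \<le> 1"
      using powr_less_mono2[OF e, of 1 "?\<kappa> / t"] by linarith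
  next
    assume "?\<kappa> / t \<le> 1"
    then show "(?\<kappa> / t) powr ?e \<le> 1 powr ?e"
      using True e kappa_pos[OF assms(1), of "CARD('n)"] by (intro powr_mono2) auto
  qed
  then show ?thesis
    using True by (simp add: feasible_forms_iff forms_cmult ball_form_in_forms assms
      exp_integral_multiple_of_ball_form field_simps)
next
  case False
  then have "exp_integral (\<lambda>x :: real^'n. t * ball_form d x) = \<infinity>"
    by (intro exp_integral_nonpos) (simp add: ball_form_def mult_nonpos_nonneg)
  with False show ?thesis
    using kappa_pos[OF assms(1), of "CARD('n)"] by (auto simp: feasible_forms_iff top_unique)
qed

text \<open>Markov's inequality for \<open>exp (- f)\<close>: its integral bounds \<open>exp (- 1)\<close> times the volume.\<close>

lemma feasible_imp_finite_volume:
  fixes f :: "real^'n \<Rightarrow> real"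
  assumes "f \<in> feasible_forms d"
  shows "f \<in> finite_volume_forms d"
proof -
  have f: "f \<in> forms d" and le: "exp_integral f \<le> 1"
    using assms by (auto simp: feasible_forms_iff)
  have [measurable]: "f \<in> borel_measurable borel" using f by (rule borel_measurable_form)
  have "emeasure lborel {x. f x \<le> 1} = (\<integral>\<^sup>+x. indicator {x. f x \<le> 1} x \<partial>lborel)"
    by simp
  also have "\<dots> \<le> (\<integral>\<^sup>+x. ennreal (exp 1) * ennreal (exp (- f x)) \<partial>lborel)"
    by (intro nn_integral_mono) (simp add: indicator_def flip: ennreal_mult exp_add)
  also have "\<dots> = ennreal (exp 1) * exp_integral f"
    by (simp add: nn_integral_cmult exp_integral_def)
  also have "\<dots> \<le> ennreal (exp 1) * 1"
    by (intro mult_left_mono le) simp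
  also have "\<dots> < \<infinity>" by simp
  finally show ?thesis using f by (simp add: finite_volume_forms_def)
qed

text \<open>Fatou's lemma; this makes the feasible set closed.\<close>

lemma exp_integral_pointwise_limit:
  fixes f :: "nat \<Rightarrow> real^'n \<Rightarrow> real"
  assumes "\<And>k. f k \<in> forms d" "\<And>k. exp_integral (f k) \<le> B" "\<And>x. (\<lambda>k. f k x) \<longlonglongrightarrow> l x"
  shows "exp_integral l \<le> B"
proof -
  have [measurable]: "f k \<in> borel_measurable borel" for k
    using assms(1) by (rule borel_measurable_form)
  have "(\<lambda>k. ennreal (exp (- f k x))) \<longlonglongrightarrow> ennreal (exp (- l x))" for x
    by (intro tendsto_intros assms)
  then have "exp_integral l = (\<integral>\<^sup>+x. liminf (\<lambda>k. ennreal (exp (- f k x))) \<partial>lborel)"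
    unfolding exp_integral_def by (intro nn_integral_cong) (metis lim_imp_Liminf sequentially_bot)
  also have "\<dots> \<le> liminf (\<lambda>k. exp_integral (f k))"
    unfolding exp_integral_def by (intro nn_integral_liminf) simp
  also have "\<dots> \<le> liminf (\<lambda>k. B)"
    by (intro Liminf_mono always_eventually allI assms)
  also have "\<dots> = B" by (simp add: Liminf_const)
  finally show ?thesis .
qed

text \<open>The exponential is strictly convex, and two distinct forms, being continuous, differ on a set
  of positive measure.\<close>

lemma exp_integral_midpoint_less:
  fixes f g :: "real^'n \<Rightarrow> real"
  assumes f: "f \<in> forms d" and g: "g \<in> forms d" and "f \<noteq> g"
    and If: "exp_integral f \<le> 1" and Ig: "exp_integral g \<le> 1"
  shows "exp_integral (\<lambda>x. (f x + g x) / 2) < 1"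
proof -
  have [measurable]: "f \<in> borel_measurable borel" "g \<in> borel_measurable borel"
    using f g by (auto intro: borel_measurable_form)
  let ?h = "\<lambda>x. (f x + g x) / 2"
  let ?avg = "\<lambda>x. ennreal ((exp (- f x) + exp (- g x)) / 2)"
  \<comment> \<open>The convexity defect is a square, so it vanishes only where \<open>f\<close> and \<open>g\<close> agree.\<close>
  have gap: "(exp (- a) + exp (- b)) / 2 - exp (- ((a + b) / 2)) = (exp (- a / 2) - exp (- b / 2))\<^sup>2 / 2"
    for a b :: real
  proof -
    have "exp (- a) = exp (- a / 2) ^ 2" "exp (- b) = exp (- b / 2) ^ 2"
         "exp (- ((a + b) / 2)) = exp (- a / 2) * exp (- b / 2)"
      by (simp_all add: power2_eq_square field_simps flip: exp_add)
    then show ?thesis by (simp only:) (simp add: power2_eq_square field_simps)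
  qed
  have le: "exp (- ?h x) \<le> (exp (- f x) + exp (- g x)) / 2" for x
    using gap[of "f x" "g x"] by (smt (verit) zero_le_power2 divide_nonneg_pos)
  have half: "ennreal ((a + b) / 2) = ennreal (1/2) * (ennreal a + ennreal b)"
    if "0 \<le> a" "0 \<le> b" for a b :: real
    using ennreal_mult'[of "1/2" "a + b"] ennreal_plus[OF that] by (simp only:) simp
  have "(\<integral>\<^sup>+x. ?avg x \<partial>lborel) = (\<integral>\<^sup>+x. ennreal (1/2) * (ennreal (exp (- f x)) + ennreal (exp (- g x))) \<partial>lborel)"
    by (intro nn_integral_cong half) auto
  also have "\<dots> = ennreal (1/2) * (exp_integral f + exp_integral g)"
    by (simp add: nn_integral_cmult nn_integral_add exp_integral_def)
  also have "\<dots> \<le> ennreal (1/2) * (1 + 1)"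
    by (intro mult_left_mono add_mono If Ig) simp
  also have "\<dots> = ennreal (1/2) * ennreal 2" by simp
  also have "\<dots> = 1" by (subst ennreal_mult[symmetric]) simp_all
  finally have avg: "(\<integral>\<^sup>+x. ?avg x \<partial>lborel) \<le> 1" .
  have "exp_integral ?h \<le> (\<integral>\<^sup>+x. ?avg x \<partial>lborel)"
    unfolding exp_integral_def by (intro nn_integral_mono ennreal_leI le)
  also note avg
  finally have fin: "exp_integral ?h \<noteq> \<infinity>"
    by (auto simp: top_unique)
  have "\<not> (AE x in lborel. ?avg x \<le> ennreal (exp (- ?h x)))"
  proof
    assume "AE x in lborel. ?avg x \<le> ennreal (exp (- ?h x))"
    then have "AE x in lborel. x \<in> {x. f x = g x}"
    proof eventually_elim
      case (elim x)
      then have "(exp (- f x) + exp (- g x)) / 2 \<le> exp (- ?h x)" by simp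
      then have "(exp (- f x / 2) - exp (- g x / 2))\<^sup>2 \<le> 0" using gap[of "f x" "g x"] by linarith
      then show ?case by simp
    qed
    then have "AE x in lebesgue. x \<in> {x. f x = g x}" by (rule AE_completion)
    moreover have "closed {x. f x = g x}"
      by (intro closed_Collect_eq continuous_on_form[OF f] continuous_on_form[OF g])
    ultimately have "f x = g x" for x using mem_closed_if_AE_lebesgue[of "{x. f x = g x}" x] by simp
    with \<open>f \<noteq> g\<close> show False by auto
  qed
  then have "exp_integral ?h < (\<integral>\<^sup>+x. ?avg x \<partial>lborel)"
    using fin le unfolding exp_integral_def
    by (intro nn_integral_less) (auto intro!: always_eventually ennreal_leI)
  with avg show ?thesis by simp
qed

text \<open>Both sides are translation invariant in \<open>F\<close>, so Weil's uniqueness argument for Haar measure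
  applies: for the unit ball \<open>B\<close>, the double integral of \<open>F (\<rho> x) * indicator B (y - \<rho> x)\<close> is
  \<open>vol B\<close> times the left-hand side when \<open>y\<close> is integrated first, and, after the shift
  \<open>x \<mapsto> \<rho>\<^sup>-\<^sup>1 y + x\<close>, \<open>vol B\<close> times the right-hand side, because \<open>\<rho>\<close> preserves \<open>B\<close>.\<close>

lemma nn_integral_lborel_orthogonal:
  fixes \<rho> :: "'a::euclidean_space \<Rightarrow> 'a" and F :: "'a \<Rightarrow> ennreal"
  assumes \<rho>: "orthogonal_transformation \<rho>" and [measurable]: "F \<in> borel_measurable borel"
  shows "(\<integral>\<^sup>+x. F (\<rho> x) \<partial>lborel) = (\<integral>\<^sup>+x. F x \<partial>lborel)"
proof -
  have lin: "linear \<rho>" using \<rho> by (rule orthogonal_transformation_linear)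
  have [measurable]: "\<rho> \<in> borel_measurable borel"
    using lin by (intro borel_measurable_continuous_onI linear_continuous_on) (simp add: linear_conv_bounded_linear)
  have surj: "\<rho> (inv \<rho> y) = y" for y
    using orthogonal_transformation_surj[OF \<rho>] by (rule surj_f_inv_f)
  let ?B = "ball (0 :: 'a) 1"
  let ?b = "emeasure lborel ?B"
  define ind :: "'a \<Rightarrow> ennreal" where "ind = indicator ?B"
  have [measurable]: "ind \<in> borel_measurable borel"
    by (simp add: ind_def borel_measurable_indicator)
  have ind: "(\<integral>\<^sup>+x. ind x \<partial>lborel) = ?b" by (simp add: ind_def)
  have translate: "(\<integral>\<^sup>+y. g (c + y) \<partial>lborel) = (\<integral>\<^sup>+y. g y \<partial>lborel)"
    if [measurable]: "g \<in> borel_measurable borel" for g :: "'a \<Rightarrow> ennreal" and c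
  proof -
    have "(\<integral>\<^sup>+y. g y \<partial>lborel) = (\<integral>\<^sup>+y. g y \<partial>distr lborel borel ((+) c))"
      by (simp only: lborel_distr_plus)
    also have "\<dots> = (\<integral>\<^sup>+y. g (c + y) \<partial>lborel)" by (rule nn_integral_distr) simp_all
    finally show ?thesis by simp
  qed
  have "(\<integral>\<^sup>+x. F (\<rho> x) \<partial>lborel) * ?b = (\<integral>\<^sup>+x. F (\<rho> x) * ?b \<partial>lborel)"
    by (simp add: nn_integral_multc)
  also have "\<dots> = (\<integral>\<^sup>+x. \<integral>\<^sup>+y. F (\<rho> x) * ind (y - \<rho> x) \<partial>lborel \<partial>lborel)"
  proof (rule nn_integral_cong)
    fix x
    have "(\<integral>\<^sup>+y. ind (y - \<rho> x) \<partial>lborel) = ?b"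
      using translate[of ind "- \<rho> x"] ind by simp
    then show "F (\<rho> x) * ?b = (\<integral>\<^sup>+y. F (\<rho> x) * ind (y - \<rho> x) \<partial>lborel)"
      by (simp add: nn_integral_cmult)
  qed
  also have "\<dots> = (\<integral>\<^sup>+y. \<integral>\<^sup>+x. F (\<rho> x) * ind (y - \<rho> x) \<partial>lborel \<partial>lborel)"
    by (rule lborel_pair.Fubini') measurable
  also have "\<dots> = (\<integral>\<^sup>+y. \<integral>\<^sup>+x. F (\<rho> x + y) * ind x \<partial>lborel \<partial>lborel)"
  proof (rule nn_integral_cong)
    fix y
    have "(\<integral>\<^sup>+x. F (\<rho> x) * ind (y - \<rho> x) \<partial>lborel)
        = (\<integral>\<^sup>+x. F (\<rho> (inv \<rho> y + x)) * ind (y - \<rho> (inv \<rho> y + x)) \<partial>lborel)"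
      by (rule translate[symmetric]) measurable
    also have "\<dots> = (\<integral>\<^sup>+x. F (\<rho> x + y) * ind x \<partial>lborel)"
      by (simp add: linear_add[OF lin] surj ind_def indicator_def orthogonal_transformation_norm[OF \<rho>] add.commute)
    finally show "(\<integral>\<^sup>+x. F (\<rho> x) * ind (y - \<rho> x) \<partial>lborel)
        = (\<integral>\<^sup>+x. F (\<rho> x + y) * ind x \<partial>lborel)" .
  qed
  also have "\<dots> = (\<integral>\<^sup>+x. \<integral>\<^sup>+y. F (\<rho> x + y) * ind x \<partial>lborel \<partial>lborel)"
    by (rule lborel_pair.Fubini') measurable
  also have "\<dots> = (\<integral>\<^sup>+x. (\<integral>\<^sup>+y. F y \<partial>lborel) * ind x \<partial>lborel)"
    by (simp add: nn_integral_multc translate)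
  also have "\<dots> = (\<integral>\<^sup>+y. F y \<partial>lborel) * ?b"
    by (simp add: nn_integral_cmult ind)
  finally have "(\<integral>\<^sup>+x. F (\<rho> x) \<partial>lborel) * ?b / ?b = (\<integral>\<^sup>+y. F y \<partial>lborel) * ?b / ?b" by simp
  moreover have "?b \<noteq> 0" "?b \<noteq> top"
    using unit_ball_vol_pos[of "real DIM('a)"]
    by (simp_all add: emeasure_ball less_imp_neq[THEN not_sym])
  ultimately show ?thesis by (simp add: mult_divide_eq_ennreal)
qed

lemma exp_integral_orthogonal:
  fixes f :: "real^'n \<Rightarrow> real" and \<rho> :: "real^'n \<Rightarrow> real^'n"
  assumes "f \<in> forms d" "orthogonal_transformation \<rho>"
  shows "exp_integral (\<lambda>x. f (\<rho> x)) = exp_integral f"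
proof -
  have [measurable]: "f \<in> borel_measurable borel" using assms(1) by (rule borel_measurable_form)
  show ?thesis
    unfolding exp_integral_def by (rule nn_integral_lborel_orthogonal[OF assms(2)]) measurable
qed

section \<open>The optimization problem\<close>

lemma opt_value_le:
  assumes "norm_on_forms d N" "f \<in> feasible_forms d"
  shows "opt_value d N \<le> N f"
  unfolding opt_value_def
proof (rule cINF_lower[OF _ assms(2)])
  show "bdd_below (N ` feasible_forms d)"
    using norm_on_forms_nonneg[OF assms(1)] by (auto simp: feasible_forms_iff intro!: bdd_belowI[of _ 0])
qed

text \<open>The direct method: a norm-bounded minimizing sequence subconverges to a feasible form, and the
  norm is continuous along the subsequence.\<close>

lemma optimal_solution_exists:
  fixes N :: "(real^'n \<Rightarrow> real) \<Rightarrow> real"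
  assumes "d > 0" "even d" and N: "norm_on_forms d N"
  shows "\<exists>f. optimal_solution d N f"
proof -
  let ?opt = "opt_value d N"
  have ne: "(feasible_forms d :: (real^'n \<Rightarrow> real) set) \<noteq> {}"
    using multiple_of_ball_form_feasible_iff[OF assms(1,2), of "kappa d CARD('n)"] by blast
  have "\<exists>f\<in>feasible_forms d. N f < ?opt + inverse (real (Suc k))" for k
    using cInf_lessD[of "N ` feasible_forms d" "?opt + inverse (real (Suc k))"] ne
    unfolding opt_value_def by auto
  then obtain f where F: "\<And>k. f k \<in> feasible_forms d"
    and less: "\<And>k. N (f k) < ?opt + inverse (real (Suc k))" by metis
  have f: "f k \<in> forms d" and I: "exp_integral (f k) \<le> 1" for k
    using F by (auto simp: feasible_forms_iff)
  have bound: "N (f k) \<le> ?opt + 1" for k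
  proof -
    have "inverse (real (Suc k)) \<le> 1" by (simp add: inverse_le_1_iff)
    with less[of k] show ?thesis by linarith
  qed
  obtain r l where r: "strict_mono r" and l': "l \<in> forms_over (multidegrees d)"
      and lim: "(\<lambda>k. N (\<lambda>x. f (r k) x - l x)) \<longlonglongrightarrow> 0" and pt: "\<forall>x. (\<lambda>k. f (r k) x) \<longlonglongrightarrow> l x"
    using forms_over_bounded_subsequence[of d N "multidegrees d" f, OF N subset_refl
        f[unfolded forms_eq_forms_over] bound]
    by (elim exE conjE) (rule that; assumption)
  have l: "l \<in> forms d" using l' by (simp add: forms_eq_forms_over)
  have feas: "l \<in> feasible_forms d"
    using l exp_integral_pointwise_limit[of "\<lambda>k. f (r k)" d 1 l, OF f I] pt
    by (simp add: feasible_forms_iff)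
  have le: "N l \<le> ?opt + inverse (real (Suc (r k))) + N (\<lambda>x. f (r k) x - l x)" for k
  proof -
    have "N (\<lambda>x. f (r k) x + (l x - f (r k) x)) \<le> N (f (r k)) + N (\<lambda>x. l x - f (r k) x)"
      by (rule norm_on_forms_triangle[OF N f forms_diff[OF l f]])
    then show ?thesis
      using less[of "r k"] norm_on_forms_diff_commute[OF N l f, of "r k"] by simp
  qed
  have "(\<lambda>k. inverse (real (Suc (r k)))) \<longlonglongrightarrow> 0"
    using LIMSEQ_subseq_LIMSEQ[OF LIMSEQ_inverse_real_of_nat r] by (simp add: o_def)
  then have "(\<lambda>k. ?opt + inverse (real (Suc (r k))) + N (\<lambda>x. f (r k) x - l x)) \<longlonglongrightarrow> ?opt + 0 + 0"
    by (intro tendsto_add tendsto_const lim)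
  then have "N l \<le> ?opt + 0 + 0"
    by (rule LIMSEQ_le_const) (use le in auto)
  with opt_value_le[OF N feas] feas show ?thesis
    by (auto simp: optimal_solution_def)
qed

text \<open>If the constraint is slack at \<open>f\<close>, then by homogeneity \<open>t f\<close> remains feasible for
  some \<open>t < 1\<close>, and it has smaller norm.\<close>

lemma opt_value_less_of_slack:
  fixes f :: "real^'n \<Rightarrow> real"
  assumes "d > 0" and N: "norm_on_forms d N" and f: "f \<in> forms d" and slack: "exp_integral f < 1"
  shows "opt_value d N < N f"
proof -
  let ?e = "real CARD('n) / d"
  have "f \<noteq> (\<lambda>x. 0)" using slack exp_integral_nonpos[of f] by auto
  then have pos: "N f > 0"
    using norm_on_forms_nonneg[OF N f] norm_on_forms_eq_0[OF N f] by linarith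
  obtain q where q: "exp_integral f = ennreal q" "q \<ge> 0" "q < 1"
    using slack by (cases "exp_integral f") auto
  \<comment> \<open>The midpoint, rather than \<open>q\<close>, serves as the new level because it is visibly positive.\<close>
  define u where "u = (1 + q) / 2"
  define t where "t = u powr (1 / ?e)"
  have u: "0 < u" "u < 1" "q \<le> u" using q by (auto simp: u_def)
  have t: "t > 0" "t powr ?e = u" using u assms(1) by (simp_all add: t_def powr_powr)
  have "t < 1"
    using u assms(1) powr_less_mono2[of "1 / ?e" u 1] by (simp add: t_def)
  have "ennreal u * exp_integral (\<lambda>x. t * f x) = ennreal q"
    using exp_integral_scale[OF f assms(1) t(1)] t(2) q(1) by simp
  also have "\<dots> \<le> ennreal u * 1" using u(3) by (simp add: ennreal_leI)
  finally have "exp_integral (\<lambda>x. t * f x) \<le> 1"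
    using u(1) by (subst (asm) ennreal_mult_le_mult_iff) (auto simp: ennreal_eq_0_iff)
  then have "opt_value d N \<le> N (\<lambda>x. t * f x)"
    using f by (intro opt_value_le[OF N]) (simp add: feasible_forms_iff forms_cmult)
  also have "\<dots> = t * N f" using t(1) by (simp add: norm_on_forms_cmult[OF N f])
  also have "\<dots> < N f" using \<open>t < 1\<close> pos by simp
  finally show ?thesis .
qed

text \<open>The midpoint of two distinct minimizers would have a slack constraint, and so a norm above the
  optimum, against the triangle inequality.\<close>

lemma optimal_solution_unique:
  fixes f g :: "real^'n \<Rightarrow> real"
  assumes "d > 0" and N: "norm_on_forms d N"
    and "optimal_solution d N f" "optimal_solution d N g"
  shows "f = g"
proof (rule ccontr)
  assume "f \<noteq> g"
  have f: "f \<in> forms d" "exp_integral f \<le> 1" "N f = opt_value d N"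
    and g: "g \<in> forms d" "exp_integral g \<le> 1" "N g = opt_value d N"
    using assms(3,4) by (auto simp: optimal_solution_def feasible_forms_iff)
  let ?h = "\<lambda>x. (f x + g x) / 2"
  have h_eq: "?h = (\<lambda>x. 1/2 * (f x + g x))" by (simp add: fun_eq_iff)
  have "N ?h = 1/2 * N (\<lambda>x. f x + g x)"
    unfolding h_eq using norm_on_forms_cmult[OF N forms_add[OF f(1) g(1)], of "1/2"] by simp
  also have "\<dots> \<le> opt_value d N"
    using norm_on_forms_triangle[OF N f(1) g(1)] f(3) g(3) by simp
  also have "\<dots> < N ?h"
  proof (rule opt_value_less_of_slack[OF assms(1) N])
    show "?h \<in> forms d" unfolding h_eq by (intro forms_cmult forms_add f g)
    show "exp_integral ?h < 1"
      using exp_integral_midpoint_less[OF f(1) g(1) \<open>f \<noteq> g\<close> f(2) g(2)] .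
  qed
  finally show False by simp
qed

lemma optimal_solution_orthogonal_action:
  fixes f :: "real^'n \<Rightarrow> real"
  assumes inv: "orthogonally_invariant d N" and opt: "optimal_solution d N f"
    and \<rho>: "orthogonal_transformation \<rho>"
  shows "optimal_solution d N (orthogonal_action \<rho> f)"
proof -
  have f: "f \<in> forms d" "exp_integral f \<le> 1" "N f = opt_value d N"
    using opt by (auto simp: optimal_solution_def feasible_forms_iff)
  have \<rho>': "orthogonal_transformation (inv \<rho>)" using \<rho> by (rule orthogonal_transformation_inv)
  have "orthogonal_action \<rho> f \<in> forms d"
    unfolding orthogonal_action_def by (rule forms_linear_comp[OF f(1) orthogonal_transformation_linear[OF \<rho>']])
  moreover have "exp_integral (orthogonal_action \<rho> f) = exp_integral f"
    unfolding orthogonal_action_def by (rule exp_integral_orthogonal[OF f(1) \<rho>'])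
  moreover have "N (orthogonal_action \<rho> f) = N f"
    using inv \<rho> f(1) by (simp add: orthogonally_invariant_def)
  ultimately show ?thesis
    using f by (simp add: optimal_solution_def feasible_forms_iff)
qed

text \<open>\<open>O(n)\<close> is transitive on spheres, so invariance makes \<open>f\<close> constant on them, and homogeneity
  gives the dependence on the radius.\<close>

lemma orthogonally_invariant_form_eq_ball_form:
  fixes f :: "real^'n \<Rightarrow> real"
  assumes f: "f \<in> forms d"
    and inv: "\<And>\<rho>. orthogonal_transformation \<rho> \<Longrightarrow> orthogonal_action \<rho> f = f"
  obtains t where "f = (\<lambda>x. t * ball_form d x)"
proof
  fix i :: 'n
  define e :: "real^'n" where "e = axis i 1"
  show "f = (\<lambda>x. f e * ball_form d x)"
  proof
    fix x :: "real^'n"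
    have "norm x = norm (norm x *\<^sub>R e)" by (simp add: e_def)
    then obtain \<rho> where \<rho>: "orthogonal_transformation \<rho>" "\<rho> x = norm x *\<^sub>R e"
      by (rule orthogonal_transformation_exists)
    have "inv \<rho> (norm x *\<^sub>R e) = x"
      using \<rho> by (metis bij_is_inj inv_f_f orthogonal_transformation_bij)
    then have "f x = orthogonal_action \<rho> f (norm x *\<^sub>R e)" by (simp add: orthogonal_action_def)
    also have "\<dots> = f e * ball_form d x"
      by (simp add: inv[OF \<rho>(1)] forms_homogeneous[OF f] ball_form_def)
    finally show "f x = f e * ball_form d x" .
  qed
qed

lemma optimal_solution_of_invariant_norm:
  fixes f :: "real^'n \<Rightarrow> real"
  assumes d: "d > 0" "even d" and N: "norm_on_forms d N"
    and inv: "orthogonally_invariant d N" and opt: "optimal_solution d N f"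
  shows "f = (\<lambda>x. kappa d CARD('n) * ball_form d x)"
proof -
  have f: "f \<in> forms d" "f \<in> feasible_forms d" "N f = opt_value d N"
    using opt by (auto simp: optimal_solution_def feasible_forms_iff)
  have "orthogonal_action \<rho> f = f" if "orthogonal_transformation \<rho>" for \<rho>
    using optimal_solution_unique[OF d(1) N optimal_solution_orthogonal_action[OF inv opt that] opt] .
  then obtain t where t: "f = (\<lambda>x. t * ball_form d x)"
    using orthogonally_invariant_form_eq_ball_form[OF f(1)] by blast
  have ge: "kappa d CARD('n) \<le> t"
    using f(2) multiple_of_ball_form_feasible_iff[OF d, of t, where 'n = 'n] by (simp add: t)
  have \<kappa>: "kappa d CARD('n) > 0" using d by (intro kappa_pos) auto
  let ?b = "ball_form d :: real^'n \<Rightarrow> real"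
  have b: "?b \<in> forms d" by (rule ball_form_in_forms[OF d(2)])
  have "?b (axis undefined 1) \<noteq> 0" by (simp add: ball_form_def)
  then have "N ?b \<noteq> 0" using norm_on_forms_eq_0[OF N b] by auto
  then have pos: "N ?b > 0" using norm_on_forms_nonneg[OF N b] by linarith
  have "t * N ?b = N f"
    unfolding t using norm_on_forms_cmult[OF N b, of t] ge \<kappa> by simp
  also have "\<dots> \<le> N (\<lambda>x. kappa d CARD('n) * ?b x)"
    unfolding f(3) by (rule opt_value_le[OF N]) (simp add: multiple_of_ball_form_feasible_iff[OF d])
  also have "\<dots> = kappa d CARD('n) * N ?b"
    using norm_on_forms_cmult[OF N b, of "kappa d CARD('n)"] \<kappa> by simp
  finally have "t \<le> kappa d CARD('n)" using pos by simp
  with ge t show ?thesis by simp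
qed

theorem mainTheorem3:
  fixes d :: nat and N :: "(real^'n \<Rightarrow> real) \<Rightarrow> real"
  assumes "d \<ge> 2" and "even d" and "norm_on_forms d N"
  shows "(\<exists>!f. optimal_solution d N f) \<and>
    (\<forall>f. optimal_solution d N f \<longrightarrow> f \<in> finite_volume_forms d) \<and>
    (orthogonally_invariant d N \<longrightarrow>
      (\<forall>f. optimal_solution d N f \<longrightarrow> f = (\<lambda>x. kappa d CARD('n) * ball_form d x)) \<and>
      opt_value d N = kappa d CARD('n) * N (ball_form d))"
proof (intro conjI allI impI)
  have d: "d > 0" using assms(1) by simp
  obtain f where f: "optimal_solution d N f"
    using optimal_solution_exists[OF d assms(2,3)] by blast
  show "\<exists>!f. optimal_solution d N f"
    using f optimal_solution_unique[OF d assms(3)] by blast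
  show "g \<in> finite_volume_forms d" if "optimal_solution d N g" for g
    using that feasible_imp_finite_volume by (auto simp: optimal_solution_def)
  assume inv: "orthogonally_invariant d N"
  show eq: "g = (\<lambda>x. kappa d CARD('n) * ball_form d x)" if "optimal_solution d N g" for g
    using optimal_solution_of_invariant_norm[OF d assms(2,3) inv that] .
  have "opt_value d N = N (\<lambda>x. kappa d CARD('n) * ball_form d x)"
    using f eq[OF f] by (simp add: optimal_solution_def)
  also have "\<dots> = kappa d CARD('n) * N (ball_form d)"
    using norm_on_forms_cmult[OF assms(3) ball_form_in_forms[OF assms(2)], of "kappa d CARD('n)"]
      kappa_pos[OF d, of "CARD('n)"] by simp
  finally show "opt_value d N = kappa d CARD('n) * N (ball_form d)" .
qed

end
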